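(* Let $n \in \mathbb{N}$ and let $M_n$ be the Plactic monoid of rank $n$. Then $(C,\mathcal{T})$ is a finite complete rewriting system for $M_n$; that is, $C$ and $\mathcal{T}$ are finite, the rewriting system $(C,\mathcal{T})$ is noetherian and confluent, and $\langle C \mid \mathcal{T}\rangle$ is a presentation of $M_n$, with each generator $c_\alpha$ representing the element of $M_n$ represented by the word $\alpha$.
   Context: Let $n \in \mathbb{N} = \{1,2,\ldots\}$ and let $A = \{1<2<\cdots<n\}$. The Plactic monoid $M_n$ (of rank $n$) is the monoid presented by $\langle A \mid \mathcal{R}\rangle$, where $\mathcal{R} = \{(xzy,zxy) : x \le y < z\} \cup \{(yxz,yzx) : x<y\le z\}$ with $x,y,z\in A$. For $u,v\in A^*$, $u=_{M_n}v$ means that $u$ and $v$ represent the same element of $M_n$. A row is a non-decreasing word in $A^*$. A row $\alpha_1\cdots\alpha_k$ dominates a row $\beta_1\cdots\beta_l$ (with $\alpha_i,\beta_i\in A$) if $k\le l$ and $\alpha_i>\beta_i$ for $i=1,\ldots,k$. Every $w\in A^*$ decomposes uniquely as a product of rows of maximal length $w=\alpha^{(1)}\cdots\alpha^{(k)}$; $w$ is a tableau if $\alpha^{(i)}$ dominates $\alpha^{(i+1)}$ for all $i=1,\ldots,k-1$. A tableau is drawn in planar form by writing its rows left-justified one below another, $\alpha^{(1)}$ at the top and $\alpha^{(k)}$ at the bottom; its columns are read from top to bottom. It is a known fact that tableaux form a cross-section of $M_n$: for each $u\in A^*$ there is a unique tableau $P(u)$ with $P(u)=_{M_n}u$. A column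 is a strictly decreasing word $\alpha=\alpha_k\cdots\alpha_1\in A^*$ ($\alpha_{i+1}>\alpha_i$ for all $i$). For columns $\alpha=\alpha_k\cdots\alpha_1$ and $\beta=\beta_l\cdots\beta_1$, write $\alpha\succeq\beta$ if $k\ge l$ and $\alpha_i\le\beta_i$ for all $i\le l$. Let $C=\{c_\alpha : \alpha \text{ a non-empty column}\}$ be a set of new symbols. The set $\mathcal{T}$ of rewriting rules on $C^*$ consists of: all rules $c_\alpha c_\beta\rightarrow c_\gamma$ where $\alpha\not\succeq\beta$ and $P(\alpha\beta)$ consists of one column $\gamma$; and all rules $c_\alpha c_\beta\rightarrow c_\gamma c_\delta$ where $\alpha\not\succeq\beta$ and $P(\alpha\beta)$ consists of exactly two columns, left column $\gamma$ and right column $\delta$. A rewriting system is complete if it is noetherian (there is no infinite sequence of one-step rewritings) and confluent (any two words obtained by rewriting from a common word can be rewritten to a common word). *)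

theory Defs
  imports "HOL-Algebra.Group"
begin

section \<open>String rewriting and monoid presentations\<close>

definition rewriting_system :: "'a set \<Rightarrow> ('a list \<times> 'a list) set \<Rightarrow> bool" where
  "rewriting_system A R \<longleftrightarrow> R \<subseteq> lists A \<times> lists A"

definition rewrite_step :: "'a set \<Rightarrow> ('a list \<times> 'a list) set \<Rightarrow> ('a list \<times> 'a list) set" where
  "rewrite_step A R =
     {(p @ l @ q, p @ r @ q) | p l r q. p \<in> lists A \<and> q \<in> lists A \<and> (l, r) \<in> R}"

definition noetherian :: "'a set \<Rightarrow> ('a list \<times> 'a list) set \<Rightarrow> bool" where
  "noetherian A R \<longleftrightarrow> (\<nexists>f :: nat \<Rightarrow> 'a list. \<forall>i. (f i, f (Suc i)) \<in> rewrite_step A R)"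

definition confluent :: "'a set \<Rightarrow> ('a list \<times> 'a list) set \<Rightarrow> bool" where
  "confluent A R \<longleftrightarrow>
     (\<forall>w \<in> lists A. \<forall>u v. (w, u) \<in> (rewrite_step A R)\<^sup>* \<and> (w, v) \<in> (rewrite_step A R)\<^sup>* \<longrightarrow>
        (\<exists>z. (u, z) \<in> (rewrite_step A R)\<^sup>* \<and> (v, z) \<in> (rewrite_step A R)\<^sup>*))"

definition complete_rewriting_system :: "'a set \<Rightarrow> ('a list \<times> 'a list) set \<Rightarrow> bool" where
  "complete_rewriting_system A R \<longleftrightarrow> rewriting_system A R \<and> noetherian A R \<and> confluent A R"

definition finite_complete_rewriting_system :: "'a set \<Rightarrow> ('a list \<times> 'a list) set \<Rightarrow> bool" where
  "finite_complete_rewriting_system A R \<longleftrightarrow>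
     finite A \<and> finite R \<and> complete_rewriting_system A R"

text \<open>The congruence on the free monoid over \<open>A\<close> generated by \<open>R\<close>.\<close>

definition pres_cong :: "'a set \<Rightarrow> ('a list \<times> 'a list) set \<Rightarrow> ('a list \<times> 'a list) set" where
  "pres_cong A R =
     (rewrite_step A R \<union> (rewrite_step A R)\<inverse>)\<^sup>* \<inter> lists A \<times> lists A"

definition pres_class :: "'a set \<Rightarrow> ('a list \<times> 'a list) set \<Rightarrow> 'a list \<Rightarrow> 'a list set" where
  "pres_class A R w = pres_cong A R `` {w}"

definition presented_monoid :: "'a set \<Rightarrow> ('a list \<times> 'a list) set \<Rightarrow> 'a list set monoid" where
  "presented_monoid A R =
     \<lparr>carrier = lists A // pres_cong A R,
      mult = (\<lambda>X Y. \<Union>x\<in>X. \<Union>y\<in>Y. pres_class A R (x @ y)),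
      one = pres_class A R []\<rparr>"

lemma equiv_pres_cong: "equiv (lists A) (pres_cong A R)"
proof (rule equivI)
  show "refl_on (lists A) (pres_cong A R)"
    by (auto simp: refl_on_def pres_cong_def)
  have "sym (rewrite_step A R \<union> (rewrite_step A R)\<inverse>)"
    by (auto simp: sym_def)
  then have s: "sym ((rewrite_step A R \<union> (rewrite_step A R)\<inverse>)\<^sup>*)"
    by (rule sym_rtrancl)
  show "sym (pres_cong A R)"
    using s unfolding pres_cong_def sym_def by blast
  show "trans (pres_cong A R)"
    unfolding pres_cong_def by (rule transI) (auto intro: rtrancl_trans)
qed (auto simp: pres_cong_def)

lemma pres_cong_append:
  assumes "(u, u') \<in> pres_cong A R" "(v, v') \<in> pres_cong A R"
  shows "(u @ v, u' @ v') \<in> pres_cong A R"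
proof -
  let ?S = "rewrite_step A R \<union> (rewrite_step A R)\<inverse>"
  have in_context: "(p @ a @ q, p @ b @ q) \<in> rewrite_step A R"
    if "(a, b) \<in> rewrite_step A R" "p \<in> lists A" "q \<in> lists A" for a b p q
  proof -
    from that(1) have "\<exists>p' l r q'. (a, b) = (p' @ l @ q', p' @ r @ q') \<and>
        p' \<in> lists A \<and> q' \<in> lists A \<and> (l, r) \<in> R"
      unfolding rewrite_step_def by (rule CollectD)
    then obtain p' l r q' where *: "a = p' @ l @ q'" "b = p' @ r @ q'" "p' \<in> lists A"
        "q' \<in> lists A" "(l, r) \<in> R"
      unfolding prod.inject by iprover
    have "(p @ a @ q, p @ b @ q) = ((p @ p') @ l @ (q' @ q), (p @ p') @ r @ (q' @ q)) \<and>
        p @ p' \<in> lists A \<and> q' @ q \<in> lists A \<and> (l, r) \<in> R"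
      using *(3-5) that(2,3) by (simp add: *(1,2))
    then show ?thesis
      unfolding rewrite_step_def by (intro CollectI exI)
  qed
  have ctxt: "(p @ a @ q, p @ b @ q) \<in> ?S\<^sup>*"
    if "(a, b) \<in> ?S\<^sup>*" "p \<in> lists A" "q \<in> lists A" for a b p q
    using that(1)
  proof induction
    case (step b c)
    from step.hyps(2) have "(p @ b @ q, p @ c @ q) \<in> ?S"
    proof
      assume "(b, c) \<in> rewrite_step A R"
      then show ?thesis using in_context[OF _ that(2,3)] by (intro UnI1)
    next
      assume "(b, c) \<in> (rewrite_step A R)\<inverse>"
      then have "(c, b) \<in> rewrite_step A R" by (rule converseD)
      then show ?thesis using in_context[OF _ that(2,3)] by (intro UnI2 converseI)
    qed
    with step.IH show ?case by (rule rtrancl_into_rtrancl)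
  qed simp
  have "(u @ v, u' @ v) \<in> ?S\<^sup>*"
    using ctxt[of u u' "[]" v] assms by (auto simp: pres_cong_def)
  moreover have "(u' @ v, u' @ v') \<in> ?S\<^sup>*"
    using ctxt[of v v' u' "[]"] assms by (auto simp: pres_cong_def)
  ultimately show ?thesis
    using assms by (auto simp: pres_cong_def)
qed

lemma presented_monoid_mult:
  assumes "u \<in> lists A" "v \<in> lists A"
  shows "pres_class A R u \<otimes>\<^bsub>presented_monoid A R\<^esub> pres_class A R v = pres_class A R (u @ v)"
proof -
  have "pres_class A R (x @ y) = pres_class A R (u @ v)"
    if "x \<in> pres_class A R u" "y \<in> pres_class A R v" for x y
  proof -
    have "(u @ v, x @ y) \<in> pres_cong A R"
      using that by (intro pres_cong_append) (simp_all add: pres_class_def)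
    then show ?thesis
      using equiv_class_eq[OF equiv_pres_cong] unfolding pres_class_def by metis
  qed
  moreover have "u \<in> pres_class A R u" "v \<in> pres_class A R v"
    using assms by (auto simp: pres_class_def pres_cong_def)
  ultimately have "(\<Union>x\<in>pres_class A R u. \<Union>y\<in>pres_class A R v. pres_class A R (x @ y)) =
      pres_class A R (u @ v)"
    by (intro subset_antisym UN_least) (blast+)
  then show ?thesis
    by (simp add: presented_monoid_def)
qed

lemma monoid_presented_monoid: "monoid (presented_monoid A R)"
proof -
  let ?M = "presented_monoid A R"
  have carr: "carrier ?M = pres_class A R ` lists A"
    by (auto simp: presented_monoid_def quotient_def pres_class_def)
  have one: "\<one>\<^bsub>?M\<^esub> = pres_class A R []"
    by (simp add: presented_monoid_def)
  have cl: "\<exists>u \<in> lists A. x = pres_class A R u" if "x \<in> carrier ?M" for x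
    using that unfolding carr by blast
  have app: "u @ v \<in> lists A" if "u \<in> lists A" "v \<in> lists A" for u v
    using that by simp
  have nil: "[] \<in> lists A" by simp
  show ?thesis
  proof (rule monoidI)
    show "\<one>\<^bsub>?M\<^esub> \<in> carrier ?M"
      unfolding carr one using nil by (rule imageI)
  next
    fix x y assume "x \<in> carrier ?M" "y \<in> carrier ?M"
    then obtain u v where *: "u \<in> lists A" "x = pres_class A R u" "v \<in> lists A" "y = pres_class A R v"
      using cl by meson
    show "x \<otimes>\<^bsub>?M\<^esub> y \<in> carrier ?M"
      unfolding * presented_monoid_mult[OF *(1,3)] carr using app[OF *(1,3)] by (rule imageI)
  next
    fix x y z assume "x \<in> carrier ?M" "y \<in> carrier ?M" "z \<in> carrier ?M"
    then obtain u v w where *: "u \<in> lists A" "x = pres_class A R u" "v \<in> lists A" "y = pres_class A R v"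
      "w \<in> lists A" "z = pres_class A R w"
      using cl by meson
    show "x \<otimes>\<^bsub>?M\<^esub> y \<otimes>\<^bsub>?M\<^esub> z = x \<otimes>\<^bsub>?M\<^esub> (y \<otimes>\<^bsub>?M\<^esub> z)"
      unfolding * presented_monoid_mult[OF *(1,3)] presented_monoid_mult[OF *(3,5)]
        presented_monoid_mult[OF app[OF *(1,3)] *(5)] presented_monoid_mult[OF *(1) app[OF *(3,5)]]
      by simp
  next
    fix x assume "x \<in> carrier ?M"
    then obtain u where *: "u \<in> lists A" "x = pres_class A R u"
      using cl by meson
    show "\<one>\<^bsub>?M\<^esub> \<otimes>\<^bsub>?M\<^esub> x = x"
      unfolding * one presented_monoid_mult[OF nil *(1)] by simp
    show "x \<otimes>\<^bsub>?M\<^esub> \<one>\<^bsub>?M\<^esub> = x"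
      unfolding * one presented_monoid_mult[OF *(1) nil] by simp
  qed
qed


section \<open>The plactic monoid and tableaux\<close>

definition plactic_alphabet :: "nat \<Rightarrow> nat set" where
  "plactic_alphabet n = {1..n}"

definition plactic_relations :: "nat \<Rightarrow> (nat list \<times> nat list) set" where
  "plactic_relations n =
     {([x, z, y], [z, x, y]) | x y z.
        {x, y, z} \<subseteq> plactic_alphabet n \<and> x \<le> y \<and> y < z} \<union>
     {([y, x, z], [y, z, x]) | x y z.
        {x, y, z} \<subseteq> plactic_alphabet n \<and> x < y \<and> y \<le> z}"

abbreviation plactic_monoid :: "nat \<Rightarrow> nat list set monoid" where
  "plactic_monoid n \<equiv> presented_monoid (plactic_alphabet n) (plactic_relations n)"

abbreviation plactic_cong :: "nat \<Rightarrow> (nat list \<times> nat list) set" where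
  "plactic_cong n \<equiv> pres_cong (plactic_alphabet n) (plactic_relations n)"

abbreviation plactic_class :: "nat \<Rightarrow> nat list \<Rightarrow> nat list set" where
  "plactic_class n \<equiv> pres_class (plactic_alphabet n) (plactic_relations n)"

text \<open>The decomposition of a word into rows (non-decreasing words) of maximal length.\<close>

fun max_rows :: "nat list \<Rightarrow> nat list list" where
  "max_rows [] = []"
| "max_rows (x # w) =
     (case max_rows w of
        [] \<Rightarrow> [[x]]
      | r # rs \<Rightarrow> if x \<le> hd r then (x # r) # rs else [x] # r # rs)"

lemma max_rows_decomposition:
  "concat (max_rows w) = w"
  "r \<in> set (max_rows w) \<Longrightarrow> r \<noteq> [] \<and> sorted r"
  "successively (\<lambda>r s. last r > hd s) (max_rows w)"
proof -
  have "concat (max_rows w) = w \<and> (\<forall>r \<in> set (max_rows w). r \<noteq> [] \<and> sorted r) \<and>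
        successively (\<lambda>r s. last r > hd s) (max_rows w)"
  proof (induction w)
    case (Cons x w)
    show ?case
    proof (cases "max_rows w")
      case Nil
      then show ?thesis
        using Cons.IH by simp
    next
      case rs: (Cons r rs)
      then obtain y r' where r: "r = y # r'"
        using Cons.IH by (cases r) auto
      have w: "w = (y # r') @ concat rs"
        using Cons.IH rs r by simp
      have "\<forall>s \<in> set rs. s \<noteq> [] \<and> sorted s" "sorted (y # r')"
        using Cons.IH rs r by simp_all
      moreover have "successively (\<lambda>r s. last r > hd s) ((y # r') # rs)"
        using Cons.IH rs r by simp
      moreover have "max_rows (x # w) =
          (if x \<le> y then (x # y # r') # rs else [x] # (y # r') # rs)"
        using rs r by simp
      moreover have "x \<le> y \<Longrightarrow> sorted (x # y # r')"
        using \<open>sorted (y # r')\<close> order_trans by auto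
      ultimately show ?thesis
        using w by (cases rs) (simp_all del: max_rows.simps add: sorted_wrt2)
    qed
  qed simp
  then show "concat (max_rows w) = w"
    "r \<in> set (max_rows w) \<Longrightarrow> r \<noteq> [] \<and> sorted r"
    "successively (\<lambda>r s. last r > hd s) (max_rows w)"
    by auto
qed

definition dominates :: "nat list \<Rightarrow> nat list \<Rightarrow> bool" where
  "dominates r s \<longleftrightarrow> length r \<le> length s \<and> (\<forall>i < length r. r ! i > s ! i)"

definition tableau :: "nat list \<Rightarrow> bool" where
  "tableau w \<longleftrightarrow> successively dominates (max_rows w)"

text \<open>The columns, from left to right and each read from top to bottom, of the left-justified
  array whose rows from top to bottom are \<open>max_rows w\<close>. In a tableau the rows get longer
  towards the bottom; \<^const>\<open>transpose\<close> skips the rows that are too short to meet a column.\<close>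

definition tableau_columns :: "nat list \<Rightarrow> nat list list" where
  "tableau_columns w = transpose (max_rows w)"

text \<open>The unique tableau representing the same element of the plactic monoid as \<open>u\<close>.\<close>

definition P_tableau :: "nat \<Rightarrow> nat list \<Rightarrow> nat list" where
  "P_tableau n u = (THE t. tableau t \<and> (t, u) \<in> plactic_cong n)"


section \<open>The rewriting system on columns\<close>

definition column :: "nat \<Rightarrow> nat list \<Rightarrow> bool" where
  "column n \<alpha> \<longleftrightarrow> \<alpha> \<in> lists (plactic_alphabet n) \<and> sorted_wrt (>) \<alpha>"

text \<open>Columns are written \<open>\<alpha>\<^sub>k \<dots> \<alpha>\<^sub>1\<close>, with indices counted from the right, that is from
  the bottom of the column.\<close>

definition col_succeq :: "nat list \<Rightarrow> nat list \<Rightarrow> bool" (infix "\<succeq>\<^sub>c" 50) where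
  "\<alpha> \<succeq>\<^sub>c \<beta> \<longleftrightarrow> length \<alpha> \<ge> length \<beta> \<and> (\<forall>i < length \<beta>. rev \<alpha> ! i \<le> rev \<beta> ! i)"

datatype col_symbol = csym "nat list"

definition col_symbols :: "nat \<Rightarrow> col_symbol set" where
  "col_symbols n = {csym \<alpha> | \<alpha>. column n \<alpha> \<and> \<alpha> \<noteq> []}"

definition col_rules :: "nat \<Rightarrow> (col_symbol list \<times> col_symbol list) set" where
  "col_rules n =
     {([csym \<alpha>, csym \<beta>], [csym \<gamma>]) | \<alpha> \<beta> \<gamma>.
        csym \<alpha> \<in> col_symbols n \<and> csym \<beta> \<in> col_symbols n \<and> \<not> \<alpha> \<succeq>\<^sub>c \<beta> \<and>
        tableau_columns (P_tableau n (\<alpha> @ \<beta>)) = [\<gamma>]} \<union>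
     {([csym \<alpha>, csym \<beta>], [csym \<gamma>, csym \<delta>]) | \<alpha> \<beta> \<gamma> \<delta>.
        csym \<alpha> \<in> col_symbols n \<and> csym \<beta> \<in> col_symbols n \<and> \<not> \<alpha> \<succeq>\<^sub>c \<beta> \<and>
        tableau_columns (P_tableau n (\<alpha> @ \<beta>)) = [\<gamma>, \<delta>]}"

end

theory Submission imports Defs begin

text \<open>Column insertion turns a word into a column followed by the word of bumped letters. It maps
  Knuth-equivalent words to the same column and to Knuth-equivalent bumped words, and it strips the
  first column off a product of columns \<open>\<gamma>\<^sub>1 \<succeq>\<^sub>c \<dots> \<succeq>\<^sub>c \<gamma>\<^sub>k\<close>; hence such a product is determined
  by its plactic class. If \<open>\<alpha> \<succeq>\<^sub>c \<beta>\<close> fails, inserting \<open>\<alpha>\<close> into \<open>\<beta>\<close> gives a product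
  \<open>\<gamma> \<delta>\<close> with \<open>\<gamma> \<succeq>\<^sub>c \<delta>\<close> and \<open>\<gamma>\<close> longer than \<open>\<alpha>\<close>. So the rules preserve plactic classes and
  move letters to the left, which makes the system noetherian, and the irreducible words are the
  products \<open>\<gamma>\<^sub>1 \<succeq>\<^sub>c \<dots> \<succeq>\<^sub>c \<gamma>\<^sub>k\<close>. As each plactic class contains just one of these, the system is
  confluent and presents the plactic monoid.\<close>

section \<open>Presentations\<close>

lemma pres_cong_refl: "w \<in> lists A \<Longrightarrow> (w, w) \<in> pres_cong A R"
  by (simp add: pres_cong_def)

lemma pres_cong_sym: "(u, v) \<in> pres_cong A R \<Longrightarrow> (v, u) \<in> pres_cong A R"
  using equiv_pres_cong[of A R] by (meson equivE symE)

lemma pres_cong_trans: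
  "(u, v) \<in> pres_cong A R \<Longrightarrow> (v, w) \<in> pres_cong A R \<Longrightarrow> (u, w) \<in> pres_cong A R"
  using equiv_pres_cong[of A R] by (meson equivE transE)

lemma pres_cong_in_lists:
  assumes "(u, v) \<in> pres_cong A R"
  shows "u \<in> lists A" "v \<in> lists A"
  using assms by (auto simp: pres_cong_def)

lemma pres_cong_append_right:
  "(u, u') \<in> pres_cong A R \<Longrightarrow> w \<in> lists A \<Longrightarrow> (u @ w, u' @ w) \<in> pres_cong A R"
  by (simp add: pres_cong_append pres_cong_refl)

lemma pres_cong_append_left:
  "(u, u') \<in> pres_cong A R \<Longrightarrow> w \<in> lists A \<Longrightarrow> (w @ u, w @ u') \<in> pres_cong A R"
  by (simp add: pres_cong_append pres_cong_refl)

lemma rewrite_stepI: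
  "p \<in> lists A \<Longrightarrow> q \<in> lists A \<Longrightarrow> (l, r) \<in> R \<Longrightarrow> (p @ l @ q, p @ r @ q) \<in> rewrite_step A R"
  unfolding rewrite_step_def by blast

lemma pres_cong_rewrite_step:
  assumes "(u, v) \<in> rewrite_step A R" "u \<in> lists A" "v \<in> lists A"
  shows "(u, v) \<in> pres_cong A R"
  using assms unfolding pres_cong_def by blast

lemma pres_cong_rule:
  assumes "(l, r) \<in> R" "l \<in> lists A" "r \<in> lists A"
  shows "(l, r) \<in> pres_cong A R"
proof (rule pres_cong_rewrite_step)
  show "(l, r) \<in> rewrite_step A R" using rewrite_stepI[OF _ _ assms(1), of "[]" A "[]"] by simp
qed (use assms in auto)

text \<open>For showing that a relation contains the congruence: besides closure as an equivalence,
  only a single rule in context needs an argument.\<close>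

lemma pres_cong_induct [consumes 1, case_names refl sym trans rule]:
  assumes uv: "(u, v) \<in> pres_cong A R"
    and refl: "\<And>w. w \<in> lists A \<Longrightarrow> Q w w"
    and sym: "\<And>u v. Q u v \<Longrightarrow> Q v u"
    and trans: "\<And>u v w. Q u v \<Longrightarrow> Q v w \<Longrightarrow> Q u w"
    and rule: "\<And>p l r q. p \<in> lists A \<Longrightarrow> q \<in> lists A \<Longrightarrow> (l, r) \<in> R \<Longrightarrow> Q (p @ l @ q) (p @ r @ q)"
  shows "Q u v"
proof -
  have "(u, v) \<in> (rewrite_step A R \<union> (rewrite_step A R)\<inverse>)\<^sup>*" "u \<in> lists A"
    using uv by (auto simp: pres_cong_def)
  then show ?thesis
  proof (induction rule: rtrancl_induct)
    case (step v w)
    have "Q a b" if "(a, b) \<in> rewrite_step A R" for a b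
      using that unfolding rewrite_step_def by (auto intro!: rule)
    then have "Q v w" using step.hyps(2) sym by blast
    then show ?case using step.IH step.prems trans by blast
  qed (rule refl)
qed

lemma carrier_presented_monoid: "carrier (presented_monoid A R) = pres_class A R ` lists A"
  by (auto simp: presented_monoid_def quotient_def pres_class_def)

lemma pres_class_eq_iff:
  assumes "u \<in> lists A" "v \<in> lists A"
  shows "pres_class A R u = pres_class A R v \<longleftrightarrow> (u, v) \<in> pres_cong A R"
  unfolding pres_class_def by (rule eq_equiv_class_iff[OF equiv_pres_cong assms])

section \<open>Column insertion\<close>

abbreviation increasing :: "nat list \<Rightarrow> bool" where
  "increasing \<equiv> sorted_wrt (<)"

text \<open>The column argument is listed from bottom to top, so it is increasing and its reading word
  is its reversal. Outputs are words of length at most one.\<close>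

fun col_insert :: "nat \<Rightarrow> nat list \<Rightarrow> nat list \<times> nat list" where
  "col_insert x [] = ([x], [])"
| "col_insert x (a # c) =
     (if x \<le> a then (x # c, [a]) else let (c', o') = col_insert x c in (a # c', o'))"

text \<open>Letters are multiplied from the left onto the column, so the last letter goes in first.\<close>

fun insert_word :: "nat list \<Rightarrow> nat list \<Rightarrow> nat list \<times> nat list" where
  "insert_word [] c = (c, [])"
| "insert_word (x # w) c =
     (let (c', u) = insert_word w c; (c'', v) = col_insert x c' in (c'', v @ u))"

lemma insert_word_append:
  "insert_word (w @ w') c =
     (let (c', u) = insert_word w' c; (c'', v) = insert_word w c' in (c'', v @ u))"
  by (induction w) (auto simp: split_def Let_def)

lemma col_insert_letters:
  "set (fst (col_insert x c)) \<subseteq> insert x (set c)" "set (snd (col_insert x c)) \<subseteq> set c"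
  by (induction c) (auto simp: split_def Let_def)

lemma insert_word_letters:
  "set (fst (insert_word w c)) \<subseteq> set w \<union> set c" "set (snd (insert_word w c)) \<subseteq> set w \<union> set c"
proof (induction w)
  case (Cons x w)
  case 1
  show ?case using Cons col_insert_letters[of x "fst (insert_word w c)"]
    by (auto simp: split_def Let_def)
  case 2
  show ?case using Cons col_insert_letters[of x "fst (insert_word w c)"]
    by (auto simp: split_def Let_def)
qed auto

text \<open>Letters above the bottom entry pass it without bumping it. This is what makes inductions
  over the column from its bottom possible.\<close>

lemma insert_word_Cons_less:
  "\<forall>x \<in> set w. a < x \<Longrightarrow>
     insert_word w (a # c) = (a # fst (insert_word w c), snd (insert_word w c))"
  by (induction w) (auto simp: split_def Let_def)

lemma col_insert_sorted: "increasing c \<Longrightarrow> increasing (fst (col_insert x c))"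
proof (induction c)
  case (Cons a c)
  then show ?case using col_insert_letters(1)[of x c]
    by (auto simp: split_def Let_def)
qed auto

lemma insert_word_sorted: "increasing c \<Longrightarrow> increasing (fst (insert_word w c))"
  by (induction w) (auto simp: split_def Let_def col_insert_sorted)

lemma col_insert_output:
  "snd (col_insert x c) = [] \<or> (\<exists>y. snd (col_insert x c) = [y] \<and> y \<in> set c \<and> x \<le> y)"
  by (induction c) (auto simp: split_def Let_def)

text \<open>The larger letter \<open>z\<close> goes beyond the place taken by \<open>y\<close>. If
  \<open>y\<close> bumps an entry, \<open>z\<close> can only bump one of the larger entries above
  it; if \<open>y\<close> lands on top, so does \<open>z\<close>.\<close>

lemma col_insert_twice_greater:
  assumes "y < z" "increasing c" "snd (col_insert z (fst (col_insert y c))) = [z']"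
  shows "\<exists>y'. snd (col_insert y c) = [y'] \<and> y' < z'"
  using assms
proof (induction c)
  case (Cons a c)
  then show ?case using col_insert_output[of z c]
    by (auto simp: split_def Let_def split: if_splits)
qed auto

text \<open>All entries below the place of \<open>z\<close> are smaller than \<open>z\<close>, so
  \<open>y\<close> stops at one of them or at \<open>z\<close> itself.\<close>

lemma col_insert_twice_le:
  assumes "y \<le> z"
  shows "\<exists>y'. snd (col_insert y (fst (col_insert z c))) = [y'] \<and> y' \<le> z"
  using assms by (induction c) (auto simp: split_def Let_def)

text \<open>The order \<open>\<succeq>\<^sub>c\<close> for columns listed from bottom to top.\<close>

definition fits_left :: "nat list \<Rightarrow> nat list \<Rightarrow> bool" where
  "fits_left a b \<longleftrightarrow> length b \<le> length a \<and> (\<forall>i < length b. a ! i \<le> b ! i)"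

lemma col_succeq_iff: "\<alpha> \<succeq>\<^sub>c \<beta> \<longleftrightarrow> fits_left (rev \<alpha>) (rev \<beta>)"
  by (simp add: col_succeq_def fits_left_def)

lemma fits_left_simps [simp]:
  "fits_left a []" "\<not> fits_left [] (y # b)"
  "fits_left (x # a) (y # b) \<longleftrightarrow> x \<le> y \<and> fits_left a b"
  by (auto simp: fits_left_def nth_Cons split: nat.splits)

text \<open>The new bottom entry shifts the others up by one place, and every entry is larger than
  the one below it.\<close>

lemma fits_left_Cons_less:
  assumes "increasing (x # a)" "fits_left a b"
  shows "fits_left (x # a) b"
  unfolding fits_left_def
proof (intro conjI allI impI)
  fix i assume i: "i < length b"
  then have "(x # a) ! i < (x # a) ! Suc i"
    using assms by (intro sorted_wrt_nth_less[of "(<)"]) (auto simp: fits_left_def)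
  then show "(x # a) ! i \<le> b ! i"
    using assms(2) i by (auto simp: fits_left_def intro: less_imp_le order_trans)
qed (use assms(2) in \<open>simp add: fits_left_def\<close>)

section \<open>Inserting a column into a column\<close>

lemma insert_column_Nil: "increasing a \<Longrightarrow> insert_word (rev a) [] = (a, [])"
  by (induction a) (simp_all add: insert_word_append insert_word_Cons_less)

text \<open>Each entry of \<open>a\<close> bumps the entry of \<open>b\<close> in the same row;
  entries of \<open>a\<close> above the top of \<open>b\<close> are put on top.\<close>

lemma insert_column_fits_left:
  "increasing a \<Longrightarrow> increasing b \<Longrightarrow> fits_left a b \<Longrightarrow> insert_word (rev a) b = (a, rev b)"
proof (induction a arbitrary: b)
  case (Cons x a)
  then show ?case
    by (cases b) (simp_all add: insert_word_append insert_word_Cons_less insert_column_Nil)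
qed (case_tac b, auto)

text \<open>Compare the bottom entries \<open>x\<close> of \<open>a\<close> and \<open>y\<close> of
  \<open>b\<close>. Either \<open>x\<close> bumps \<open>y\<close> and the rest of \<open>a\<close>
  goes into the rest of \<open>b\<close>, or \<open>y\<close> stays and all of \<open>a\<close> goes
  into the rest of \<open>b\<close>. The bumped word gets shorter than \<open>b\<close> when the
  second case occurs.\<close>

lemma insert_column:
  assumes "increasing a" "increasing b"
    and "insert_word (rev a) b = (c, u)"
  shows "set u \<subseteq> set b \<and> increasing (rev u) \<and> fits_left c (rev u) \<and>
    (\<not> fits_left a b \<longrightarrow> length u < length b)"
  using assms
proof (induction b arbitrary: a c u)
  case Nil
  then show ?case by (simp add: insert_column_Nil)
next
  case (Cons y b)
  show ?case
  proof (cases a)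
    case Nil
    then show ?thesis using Cons.prems by auto
  next
    case a: (Cons x a')
    show ?thesis
    proof (cases "x \<le> y")
      case True
      obtain c' u' where ins: "insert_word (rev a') b = (c', u')" by fastforce
      have "c = x # c'" "u = u' @ [y]"
        using Cons.prems a True ins by (auto simp: insert_word_append insert_word_Cons_less)
      then show ?thesis
        using Cons.IH[OF _ _ ins] Cons.prems a True by (auto simp: sorted_wrt_append)
    next
      case False
      obtain c' u' where ins: "insert_word (rev a) b = (c', u')" by fastforce
      have "\<forall>z \<in> set (rev a). y < z" using a Cons.prems False by auto
      then have cu: "c = y # c'" "u = u'"
        using Cons.prems(3) ins by (auto simp: insert_word_Cons_less)
      have "increasing (y # c')"
        using insert_word_sorted[of "y # b" "rev a"] Cons.prems cu by simp
      \<comment> \<open>Even if \<open>a\<close> fits to the left of \<open>b\<close> and bumps all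
        of it, the bumped word is one letter shorter than \<open>y # b\<close>.\<close>
      then show ?thesis
        using Cons.IH[OF _ _ ins] Cons.prems cu insert_column_fits_left[of a b] ins
        by (auto intro: fits_left_Cons_less)
    qed
  qed
qed

text \<open>Tableaux encoded by columns read from top to bottom, ordered from left to right. Up to
  \<open>csym\<close>, every irreducible word is such a list.\<close>

definition col_tableau :: "nat list list \<Rightarrow> bool" where
  "col_tableau cs \<longleftrightarrow> (\<forall>c \<in> set cs. c \<noteq> [] \<and> sorted_wrt (>) c) \<and> successively (\<succeq>\<^sub>c) cs"


text \<open>Every column bumps out the whole column to its right when it is inserted, so only the
  leftmost one remains.\<close>

lemma insert_word_col_tableau:
  "col_tableau (c # cs) \<Longrightarrow> insert_word (concat (c # cs)) [] = (rev c, concat cs)"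
proof (induction cs arbitrary: c)
  case Nil
  then show ?case using insert_column_Nil[of "rev c"]
    by (simp add: col_tableau_def sorted_wrt_rev)
next
  case (Cons d cs)
  have "insert_word c (rev d) = (rev c, d)"
    using insert_column_fits_left[of "rev c" "rev d"] Cons.prems
    by (simp add: col_tableau_def sorted_wrt_rev col_succeq_iff)
  moreover have "insert_word (concat (d # cs)) [] = (rev d, concat cs)"
    using Cons by (simp add: col_tableau_def)
  ultimately show ?case
    by (subst concat.simps(2), subst insert_word_append) simp
qed

section \<open>Rows and columns of tableaux\<close>

text \<open>A tableau is given from its bottom left corner, either by rows, as a grid for \<open>(<)\<close> and
  \<open>(\<le>)\<close>, or by columns, as a grid for \<open>(\<le>)\<close> and \<open>(<)\<close>.\<close>

definition grid :: "('a \<Rightarrow> 'a \<Rightarrow> bool) \<Rightarrow> ('a \<Rightarrow> 'a \<Rightarrow> bool) \<Rightarrow> 'a list list \<Rightarrow> bool" where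
  "grid P Q G \<longleftrightarrow>
     successively (\<lambda>g h. length h \<le> length g \<and> (\<forall>j < length h. P (g ! j) (h ! j))) G \<and>
     (\<forall>g \<in> set G. g \<noteq> [] \<and> successively Q g)"

text \<open>As the lengths do not increase, the lists that are long enough form an initial segment.
  Applied to the lists that \<open>transpose\<close> filters, this gives the lengths in a transposed
  grid.\<close>

lemma less_length_filter_length:
  assumes "sorted (rev (map length G))"
  shows "j < length (filter (\<lambda>g. i < length g) G) \<longleftrightarrow> j < length G \<and> i < length (G ! j)"
  using assms
proof (induction G arbitrary: j)
  case (Cons g G)
  have le: "length h \<le> length g" if "h \<in> set G" for h
    using Cons.prems that by (auto simp: sorted_append)
  have IH: "j < length (filter (\<lambda>g. i < length g) G) \<longleftrightarrow> j < length G \<and> i < length (G ! j)" for j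
    using Cons by (auto simp: sorted_append)
  show ?case
  proof (cases "i < length g")
    case True
    then show ?thesis using IH by (cases j) auto
  next
    case False
    then have "\<not> i < length h" if "h \<in> set G" for h using le[OF that] by simp
    then have "filter (\<lambda>g. i < length g) G = []" by (simp add: filter_empty_conv)
    then show ?thesis using IH False by (cases j) auto
  qed
qed simp

text \<open>Reflection in the diagonal exchanges the two directions of the grid. It is an involution
  because no list in a grid is empty.\<close>

lemma grid_transpose:
  assumes "grid P Q G"
  shows "grid Q P (transpose G)" "transpose (transpose G) = G"
proof -
  have sorted: "sorted (rev (map length G))"
    using assms by (auto simp: grid_def successively_conv_nth sorted_rev_iff_nth_Suc)
  have len: "j < length (transpose G ! i) \<longleftrightarrow> j < length G \<and> i < length (G ! j)"
    if "i < length (transpose G)" for i j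
    using that less_length_filter_length[OF sorted] by (simp add: nth_transpose)
  have nth: "transpose G ! i ! j = G ! j ! i"
    if "i < length (transpose G)" "j < length (transpose G ! i)" for i j
    using that by (intro nth_nth_transpose_sorted[OF sorted]) (auto simp: nth_transpose)
  have length: "length (transpose G ! Suc i) \<le> length (transpose G ! i)"
    if "Suc i < length (transpose G)" for i
    using that sorted_transpose[of G] by (auto simp: sorted_rev_iff_nth_Suc)
  have ne: "transpose G ! i \<noteq> []" if "i < length (transpose G)" for i
    using that len[OF that, of 0] by (auto simp: length_transpose_sorted[OF sorted] split: if_splits)
  show "grid Q P (transpose G)"
    unfolding grid_def successively_conv_nth
  proof (intro conjI allI impI ballI)
    fix i j assume i: "Suc i < length (transpose G)" and j: "j < length (transpose G ! Suc i)"
    then have "j < length G" "Suc i < length (G ! j)" using len by auto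
    then show "Q (transpose G ! i ! j) (transpose G ! Suc i ! j)"
      using i j nth length[OF i] assms by (auto simp: grid_def successively_conv_nth)
  next
    fix g i assume "g \<in> set (transpose G)" and i: "Suc i < length g"
    then obtain k where k: "g = transpose G ! k" "k < length (transpose G)"
      by (auto simp: in_set_conv_nth)
    then have "Suc i < length G" "k < length (G ! Suc i)" using i len by auto
    then show "P (g ! i) (g ! Suc i)"
      using i k nth assms by (auto simp: grid_def successively_conv_nth)
  next
    fix g assume "g \<in> set (transpose G)"
    then show "g \<noteq> []" using ne by (auto simp: in_set_conv_nth)
  qed (use length in auto)
  have "[] \<notin> set G" using assms by (auto simp: grid_def)
  then show "transpose (transpose G) = G"
    by (auto simp: transpose_transpose[OF sorted] takeWhile_eq_all_conv)
qed

text \<open>Links \<open>tableau_columns\<close>, where rows are listed from the top, with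
  \<open>grid\<close>, where they are listed from the bottom.\<close>

lemma transpose_rev: "transpose (rev R) = map rev (transpose R)"
proof (rule nth_equalityI)
  have Max: "foldr max xs 0 = Max (insert 0 (set xs))" for xs :: "nat list"
    by (induction xs) (auto simp: insert_commute)
  have "foldr max (rev (map length R)) 0 = foldr max (map length R) 0"
    by (simp add: Max)
  then show len: "length (transpose (rev R)) = length (map rev (transpose R))"
    by (simp add: length_transpose foldr_map comp_def rev_map)
  fix i assume "i < length (transpose (rev R))"
  then show "transpose (rev R) ! i = map rev (transpose R) ! i"
    using len by (simp add: nth_transpose rev_map rev_filter)
qed

section \<open>The bijection between tableaux and lists of columns\<close>

lemma col_tableau_grid: "col_tableau cs \<longleftrightarrow> grid (\<le>) (<) (map rev cs)"
proof -
  have "successively (<) (rev c) \<longleftrightarrow> sorted_wrt (>) c" for c :: "nat list"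
    by (subst successively_conv_sorted_wrt) (auto intro: transpI simp: sorted_wrt_rev)
  then show ?thesis
    by (auto simp: col_tableau_def grid_def successively_map col_succeq_iff fits_left_def
        simp del: successively_rev)
qed

lemma dominates_grid:
  "grid (<) (\<le>) (rev R) \<longleftrightarrow> successively dominates R \<and> (\<forall>r \<in> set R. r \<noteq> [] \<and> sorted r)"
proof -
  have "successively (\<le>) r \<longleftrightarrow> sorted r" for r :: "nat list"
    by (rule successively_conv_sorted_wrt) (auto intro: transpI)
  then show ?thesis by (simp add: grid_def flip: dominates_def)
qed

lemma tableau_grid: "tableau t \<longleftrightarrow> grid (<) (\<le>) (rev (max_rows t))"
  using max_rows_decomposition(2) by (auto simp: tableau_def dominates_grid)

lemma max_rows_append:
  assumes "r \<noteq> []" "sorted r" "w = [] \<or> last r > hd w"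
  shows "max_rows (r @ w) = r # max_rows w"
  using assms
proof (induction r)
  case (Cons x r)
  have hd: "hd (hd (max_rows w)) = hd w \<and> max_rows w \<noteq> []" if "w \<noteq> []" for w
    using that by (cases w) (auto split: list.splits)
  show ?case
  proof (cases "r = []")
    case True
    then show ?thesis using Cons.prems hd[of w] by (cases "w = []") (auto split: list.splits)
  next
    case False
    then show ?thesis using Cons by (cases r) auto
  qed
qed simp

text \<open>A row ends above an entry of the next row, which is at least the first entry of that
  row. So there is a descent at each boundary, and \<open>max_rows\<close> cuts exactly
  there.\<close>

lemma max_rows_concat:
  assumes "grid (<) (\<le>) (rev R)"
  shows "max_rows (concat R) = R"
  using assms
proof (induction R)
  case (Cons r R)
  have r: "r \<noteq> []" "sorted r" and R: "grid (<) (\<le>) (rev R)"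
    using Cons.prems unfolding dominates_grid by (auto simp: successively_Cons)
  have "concat R = [] \<or> last r > hd (concat R)"
  proof (cases R)
    case s: (Cons s R')
    then have *: "dominates r s" "s \<noteq> []" "sorted s" using Cons.prems unfolding dominates_grid by auto
    then have "last r > s ! (length r - 1)"
      using r by (auto simp: dominates_def last_conv_nth)
    moreover have "s ! 0 \<le> s ! (length r - 1)"
      using * r by (intro sorted_nth_mono) (cases r; auto simp: dominates_def)+
    ultimately show ?thesis using * s by (simp add: hd_conv_nth nth_append)
  qed simp
  then show ?case using max_rows_append[OF r] Cons.IH[OF R] by simp
qed simp

lemma col_tableau_tableau_columns:
  assumes "tableau t"
  shows "col_tableau (tableau_columns t)"
  using grid_transpose(1)[of "(<)" "(\<le>)" "rev (max_rows t)"] assms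
  by (simp add: col_tableau_grid tableau_grid tableau_columns_def transpose_rev)

lemma tableau_columns_surj:
  assumes "col_tableau cs"
  obtains t where "tableau t" "tableau_columns t = cs"
proof
  let ?R = "rev (transpose (map rev cs))"
  have grid: "grid (\<le>) (<) (map rev cs)" using assms by (simp add: col_tableau_grid)
  have rows: "max_rows (concat ?R) = ?R"
    using grid_transpose(1)[OF grid] by (intro max_rows_concat) simp
  then show "tableau (concat ?R)"
    using grid_transpose(1)[OF grid] by (simp add: tableau_grid)
  show "tableau_columns (concat ?R) = cs"
    using grid_transpose(2)[OF grid] rows
    by (simp add: tableau_columns_def transpose_rev comp_def)
qed

lemma tableau_columns_inj:
  assumes "tableau t" "tableau t'" "tableau_columns t = tableau_columns t'"
  shows "t = t'"
proof -
  have "rev (max_rows t) = rev (max_rows t')"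
    using assms grid_transpose(2)[of "(<)" "(\<le>)" "rev (max_rows t)"]
      grid_transpose(2)[of "(<)" "(\<le>)" "rev (max_rows t')"]
    by (simp add: tableau_grid tableau_columns_def transpose_rev)
  then show ?thesis
    using max_rows_decomposition(1) by (metis rev_rev_ident)
qed

text \<open>Serves to carry membership in the alphabet from the columns of a tableau to the
  tableau.\<close>

lemma set_concat_transpose: "set (concat (transpose R)) = set (concat R)"
proof (induction R rule: transpose.induct)
  case (3 x r R)
  have "set (concat R) = set [h. (h # t) \<leftarrow> R] \<union> set (concat [t. (h # t) \<leftarrow> R])"
  proof (induction R)
    case (Cons s R)
    then show ?case by (cases s) (simp_all, blast)
  qed simp
  then show ?case using 3 by (simp del: set_concat) auto
qed simp_all

section \<open>Plactic congruence\<close>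

context fixes n :: nat begin

abbreviation plactic_eq :: "nat list \<Rightarrow> nat list \<Rightarrow> bool"  (infix "\<approx>" 50) where
  "u \<approx> v \<equiv> (u, v) \<in> plactic_cong n"

section \<open>Column insertion and the Knuth relations\<close>

lemma plactic_knuth1:
  assumes "{x, y, z} \<subseteq> plactic_alphabet n" "x \<le> y" "y < z"
  shows "([x, z, y], [z, x, y]) \<in> plactic_cong n"
  by (rule pres_cong_rule) (use assms in \<open>auto simp: plactic_relations_def\<close>)

lemma plactic_knuth2:
  assumes "{x, y, z} \<subseteq> plactic_alphabet n" "x < y" "y \<le> z"
  shows "([y, x, z], [y, z, x]) \<in> plactic_cong n"
  by (rule pres_cong_rule) (use assms in \<open>auto simp: plactic_relations_def\<close>)

text \<open>Induction from the bottom entry \<open>b\<close>. If all three letters pass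
  \<open>b\<close>, the claim is inherited from the rest of the column; otherwise the bumped words
  are equal or again the two sides of a Knuth relation.\<close>

lemma insert_word_knuth1:
  assumes "x \<le> y" "y < z" "{x, y, z} \<subseteq> plactic_alphabet n"
    and "increasing c" "set c \<subseteq> plactic_alphabet n"
  shows "fst (insert_word [x, z, y] c) = fst (insert_word [z, x, y] c) \<and>
    snd (insert_word [x, z, y] c) \<approx> snd (insert_word [z, x, y] c)"
  using assms(4,5)
proof (induction c)
  case Nil
  then show ?case using assms by (auto intro!: pres_cong_refl)
next
  case (Cons b c)
  consider "b < x" | "y \<le> b" | "x \<le> b" "b < y" by linarith
  then show ?case
  proof cases
    case 1
    then show ?thesis using assms Cons by (simp add: insert_word_Cons_less del: insert_word.simps)
  next
    \<comment> \<open>Here \<open>y\<close> bumps \<open>b\<close>, then \<open>x\<close> bumps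
      \<open>y\<close>, and \<open>z\<close> acts only on \<open>c\<close>. If \<open>z\<close>
      bumps z', the outputs are y z' b and z' y b, where y \<le> b < z'.\<close>
    case 2
    have z: "\<not> z \<le> x" "\<not> z \<le> y" "x \<le> b" using assms 2 by auto
    show ?thesis
      using col_insert_output[of z c] Cons.prems assms 2 z
      by (auto simp: split_def Let_def intro!: pres_cong_refl plactic_knuth1)
  next
    \<comment> \<open>Here \<open>x\<close> bumps \<open>b\<close>, while \<open>y\<close> and then
      \<open>z\<close> act on \<open>c\<close>. If \<open>z\<close> bumps z', then \<open>y\<close>
      bumps some y', and the outputs are b z' y' and z' b y', where b < y' < z'.\<close>
    case 3
    define c1 where "c1 = fst (col_insert y c)"
    have z: "\<not> z \<le> x" "\<not> z \<le> b" "\<not> y \<le> b" using assms 3 by auto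
    have alph: "\<And>a. a \<in> set c \<Longrightarrow> a \<in> plactic_alphabet n \<and> b \<le> a"
      using Cons.prems by auto
    have out: "set (snd (col_insert y c)) \<subseteq> set c" "set (snd (col_insert z c1)) \<subseteq> set c \<union> {y}"
      unfolding c1_def using col_insert_letters[of z c1] col_insert_letters[of y c]
      by (auto simp: c1_def)
    have "snd (col_insert z c1) = [] \<or>
        (\<exists>z' y'. snd (col_insert z c1) = [z'] \<and> snd (col_insert y c) = [y'] \<and> z \<le> z' \<and> y' < z')"
      using col_insert_output[of z c1] col_insert_twice_greater[OF assms(2), of c] Cons.prems
      by (auto simp: c1_def)
    then have "[b] @ snd (col_insert z c1) @ snd (col_insert y c) \<approx>
        snd (col_insert z c1) @ [b] @ snd (col_insert y c)"
      using out col_insert_output[of y c] Cons.prems assms alph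
      by (auto intro!: pres_cong_refl plactic_knuth1 dest: less_imp_le)
    then show ?thesis
      using 3 z by (simp add: split_def Let_def c1_def)
  qed
qed

lemma insert_word_knuth2:
  assumes "x < y" "y \<le> z" "{x, y, z} \<subseteq> plactic_alphabet n"
    and "increasing c" "set c \<subseteq> plactic_alphabet n"
  shows "fst (insert_word [y, x, z] c) = fst (insert_word [y, z, x] c) \<and>
    snd (insert_word [y, x, z] c) \<approx> snd (insert_word [y, z, x] c)"
  using assms(4,5)
proof (induction c)
  case Nil
  then show ?case using assms by (auto intro!: pres_cong_refl)
next
  case (Cons b c)
  consider "b < x" | "z \<le> b" | "x \<le> b" "b < z" by linarith
  then show ?case
  proof cases
    case 1
    then show ?thesis using assms Cons by (simp add: insert_word_Cons_less del: insert_word.simps)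
  next
    \<comment> \<open>Here the second relation becomes the first one: if \<open>d\<close> is the
      entry above \<open>b\<close>, the outputs are d z b and z d b, where z \<le> b < d. If there
      is no such entry, both outputs are z b.\<close>
    case 2
    have z: "\<not> z \<le> x" "\<not> y \<le> x" "x \<le> b" "x \<le> z" "y \<le> b" using assms 2 by auto
    show ?thesis
    proof (cases c)
      case Nil
      then show ?thesis using z assms 2 Cons.prems by (auto intro!: pres_cong_refl)
    next
      case (Cons d c')
      then show ?thesis using z assms 2 Cons.prems
        by (auto intro!: pres_cong_sym[OF plactic_knuth1])
    qed
  next
    \<comment> \<open>Here \<open>x\<close> bumps \<open>b\<close>, while \<open>z\<close> and then
      \<open>y\<close> act on \<open>c\<close>. The letter \<open>y\<close> always bumps some y',
      and if \<open>z\<close> bumps z', the outputs are y' b z' and y' z' b, where b < y' \<le> z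
      \<le> z'.\<close>
    case 3
    define c1 where "c1 = fst (col_insert z c)"
    have z: "\<not> z \<le> x" "\<not> z \<le> b" "\<not> y \<le> x" using assms 3 by auto
    have out: "set (snd (col_insert z c)) \<subseteq> set c" "set (snd (col_insert y c1)) \<subseteq> set c \<union> {z}"
      using col_insert_letters[of y c1] col_insert_letters[of z c] by (auto simp: c1_def)
    obtain y' where y': "snd (col_insert y c1) = [y']" "y' \<le> z"
      using col_insert_twice_le[OF assms(2)] c1_def by blast
    then have "b < y'" "y' \<in> plactic_alphabet n" using out Cons.prems 3 assms by auto
    then have "[y'] @ [b] @ snd (col_insert z c) \<approx> [y'] @ snd (col_insert z c) @ [b]"
      using col_insert_output[of z c] y' Cons.prems assms
      by (auto intro!: pres_cong_refl plactic_knuth2 dest: subsetD)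
    then show ?thesis
      using 3 z y' by (simp add: split_def Let_def c1_def)
  qed
qed

text \<open>Insertion begins at the right end: the suffix \<open>q\<close> produces the column on
  which both sides of the relation act, and the prefix \<open>p\<close> then meets equal columns. So
  only the middle factor of the bumped word changes.\<close>

lemma insert_word_cong:
  assumes "u \<approx> v"
  shows "fst (insert_word u []) = fst (insert_word v []) \<and>
    snd (insert_word u []) \<approx> snd (insert_word v [])"
  using assms
proof (induction rule: pres_cong_induct)
  case (refl w)
  then show ?case using insert_word_letters[of w "[]"] by (auto intro!: pres_cong_refl)
next
  case (sym u v)
  then show ?case by (auto intro: pres_cong_sym)
next
  case (trans u v w)
  then show ?case by (auto intro: pres_cong_trans)
next
  case (rule p l r q)
  define c where "c = fst (insert_word q [])"
  have c: "increasing c" "set c \<subseteq> plactic_alphabet n"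
    and q: "snd (insert_word q []) \<in> lists (plactic_alphabet n)"
    using insert_word_letters[of q "[]"] rule insert_word_sorted[of "[]" q] by (auto simp: c_def)
  have lr: "fst (insert_word l c) = fst (insert_word r c)"
      "snd (insert_word l c) \<approx> snd (insert_word r c)" and l: "set l \<subseteq> plactic_alphabet n"
    using rule(3) insert_word_knuth1[OF _ _ _ c] insert_word_knuth2[OF _ _ _ c]
    unfolding plactic_relations_def by fastforce+
  have "snd (insert_word p (fst (insert_word l c))) \<in> lists (plactic_alphabet n)"
    using insert_word_letters[of p "fst (insert_word l c)"] insert_word_letters[of l c] rule c l
    by (auto dest!: subsetD)
  then show ?case
    using lr q
    by (auto simp: insert_word_append split_def Let_def c_def
        intro!: pres_cong_append_left pres_cong_append_right)
qed

section \<open>Column insertion preserves the plactic class\<close>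

text \<open>The letter \<open>x\<close> passes the entries of \<open>c\<close> one by one, by the
  first Knuth relation whose third letter is the next lower entry of the column.\<close>

lemma plactic_move_left:
  assumes "x \<le> a" "increasing (a # c)" "x \<in> plactic_alphabet n" "set (a # c) \<subseteq> plactic_alphabet n"
  shows "x # rev c @ [a] \<approx> rev c @ [x, a]"
  using assms
proof (induction c arbitrary: a)
  case Nil
  then show ?case by (auto intro!: pres_cong_refl)
next
  case (Cons b c)
  have "(x # rev c @ [b]) @ [a] \<approx> (rev c @ [x, b]) @ [a]"
    using Cons.prems by (intro pres_cong_append_right Cons.IH) auto
  moreover have "rev c @ [x, b, a] \<approx> rev c @ [b, x, a]"
    using Cons.prems by (intro pres_cong_append_left plactic_knuth1) auto
  ultimately show ?case using pres_cong_trans by fastforce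
qed

lemma plactic_col_insert:
  assumes "increasing c" "x \<in> plactic_alphabet n" "set c \<subseteq> plactic_alphabet n"
  shows "x # rev c \<approx> rev (fst (col_insert x c)) @ snd (col_insert x c)"
  using assms
proof (induction c)
  case Nil
  then show ?case by (auto intro!: pres_cong_refl)
next
  case (Cons a c)
  show ?case
  proof (cases "x \<le> a")
    case True
    then show ?thesis using plactic_move_left[of x a c] Cons.prems by simp
  next
    case False
    define c' v where "c' = fst (col_insert x c)" and "v = snd (col_insert x c)"
    have c': "set c' \<subseteq> insert x (set c)" and inc: "increasing c'"
      using col_insert_letters(1)[of x c] col_insert_sorted[of c x] Cons.prems by (auto simp: c'_def)
    have alph: "\<And>z. z \<in> set c' \<Longrightarrow> z \<in> plactic_alphabet n" using Cons.prems c' by auto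
    have IH: "(x # rev c) @ [a] \<approx> (rev c' @ v) @ [a]"
      unfolding c'_def v_def using Cons by (intro pres_cong_append_right) auto
    \<comment> \<open>A bumped letter \<open>y\<close> still has to pass \<open>a\<close>. The
      second Knuth relation does this, with the bottom entry \<open>b\<close> of the new column as
      left neighbour: a < b \<le> x \<le> y.\<close>
    have "rev c' @ v @ [a] \<approx> rev c' @ [a] @ v"
    proof (cases v)
      case Nil
      then show ?thesis using IH by (auto intro: pres_cong_refl dest: pres_cong_in_lists)
    next
      case (Cons y w)
      then have y: "v = [y]" "y \<in> set c" "x \<le> y"
        using col_insert_output[of x c] by (auto simp: v_def)
      have "x \<in> set c'" unfolding c'_def using assms by (induction c) (auto simp: split_def Let_def)
      then obtain b d where bd: "c' = b # d" "b \<le> x"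
        using inc by (cases c') auto
      have "a < b" using c' bd False Cons.prems by auto
      have "rev d @ [b, y, a] \<approx> rev d @ [b, a, y]"
        using Cons.prems bd y \<open>a < b\<close> alph
        by (intro pres_cong_append_left pres_cong_sym[OF plactic_knuth2]) auto
      then show ?thesis using y bd by simp
    qed
    then show ?thesis
      using IH False pres_cong_trans by (fastforce simp: split_def Let_def c'_def v_def)
  qed
qed

lemma plactic_insert_word:
  assumes "increasing c" "set w \<subseteq> plactic_alphabet n" "set c \<subseteq> plactic_alphabet n"
  shows "w @ rev c \<approx> rev (fst (insert_word w c)) @ snd (insert_word w c)"
  using assms
proof (induction w)
  case Nil
  then show ?case by (auto intro!: pres_cong_refl)
next
  case (Cons x w)
  define c' u where "c' = fst (insert_word w c)" and "u = snd (insert_word w c)"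
  have *: "set c' \<subseteq> plactic_alphabet n" "set u \<subseteq> plactic_alphabet n" "increasing c'"
    using insert_word_letters[of w c] insert_word_sorted[of c w] Cons.prems
    by (auto simp: c'_def u_def)
  have "[x] @ w @ rev c \<approx> [x] @ rev c' @ u"
    unfolding c'_def u_def using Cons by (intro pres_cong_append_left) auto
  moreover have "(x # rev c') @ u \<approx> (rev (fst (col_insert x c')) @ snd (col_insert x c')) @ u"
    using * Cons.prems by (intro pres_cong_append_right plactic_col_insert) auto
  ultimately show ?case
    using pres_cong_trans by (fastforce simp: split_def Let_def c'_def u_def)
qed

text \<open>Insertion into the empty column reads the first column off the plactic class. The bumped
  words are the products of the remaining columns and are congruent, so the argument can be
  repeated.\<close>

lemma col_tableau_unique:
  assumes "col_tableau cs" "col_tableau ds" "concat cs \<approx> concat ds"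
  shows "cs = ds"
  using assms
proof (induction cs arbitrary: ds)
  case Nil
  show ?case
  proof (cases ds)
    case (Cons d ds')
    then show ?thesis
      using Nil insert_word_col_tableau[of d ds'] insert_word_cong[OF Nil(3)]
      by (auto simp: col_tableau_def)
  qed simp
next
  case (Cons c cs)
  show ?case
  proof (cases ds)
    case Nil
    then show ?thesis
      using Cons.prems insert_word_col_tableau[of c cs] insert_word_cong[OF Cons.prems(3)]
      by (auto simp: col_tableau_def)
  next
    case ds: (Cons d ds')
    have "rev c = rev d \<and> concat cs \<approx> concat ds'"
      using insert_word_cong[OF Cons.prems(3)] insert_word_col_tableau[of c cs]
        insert_word_col_tableau[of d ds'] Cons.prems ds by simp
    moreover have "col_tableau cs" "col_tableau ds'"
      using Cons.prems ds by (auto simp: col_tableau_def successively_Cons)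
    ultimately show ?thesis using Cons.IH ds by simp
  qed
qed

section \<open>From the row reading to the column reading of a tableau\<close>

text \<open>The letter \<open>a\<close> passes the entries of \<open>c\<close> by the second Knuth
  relation. Its left neighbour is \<open>b\<close> at first and then the entry passed last.\<close>

lemma plactic_move_right:
  assumes "b \<le> a" "sorted_wrt (>) (b # c)" "set (a # b # c) \<subseteq> plactic_alphabet n"
  shows "b # a # c \<approx> b # c @ [a]"
  using assms
proof (induction c arbitrary: b)
  case Nil
  then show ?case by (auto intro!: pres_cong_refl)
next
  case (Cons d c)
  have "[b, a, d] @ c \<approx> [b, d, a] @ c"
    using Cons.prems by (intro pres_cong_append_right pres_cong_sym[OF plactic_knuth2]) auto
  moreover have "[b] @ d # a # c \<approx> [b] @ d # c @ [a]"
    using Cons.prems by (intro pres_cong_append_left Cons.IH) auto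
  ultimately show ?case using pres_cong_trans by fastforce
qed

text \<open>A hook with corner \<open>b\<close>: the letters of the row pass the column, the last
  one first, each with its predecessor in the row as corner.\<close>

lemma plactic_row_column:
  assumes "sorted (b # r)" "sorted_wrt (>) (b # c)" "set (b # r @ c) \<subseteq> plactic_alphabet n"
  shows "b # r @ c \<approx> b # c @ r"
  using assms
proof (induction r arbitrary: b)
  case Nil
  then show ?case by (auto intro!: pres_cong_refl)
next
  case (Cons a r)
  have "[b] @ a # r @ c \<approx> [b] @ a # c @ r"
    using Cons.prems by (intro pres_cong_append_left Cons.IH) (auto simp: less_le_trans)
  moreover have "(b # a # c) @ r \<approx> (b # c @ [a]) @ r"
    using Cons.prems by (intro pres_cong_append_right plactic_move_right) auto
  ultimately show ?case using pres_cong_trans by fastforce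
qed

text \<open>From the bottom row upwards, the tail of each row passes the part of the first column
  below it, with the head of the row as corner.\<close>

lemma plactic_first_column:
  assumes "sorted_wrt (>) (map hd R)" "\<forall>r \<in> set R. r \<noteq> [] \<and> sorted r"
    and "set (concat R) \<subseteq> plactic_alphabet n"
  shows "concat R \<approx> map hd R @ concat (map tl R)"
  using assms
proof (induction R)
  case Nil
  then show ?case by (auto intro!: pres_cong_refl)
next
  case (Cons r R)
  obtain b r' where r: "r = b # r'" using Cons.prems by (cases r) auto
  have tl: "set (concat (map tl R)) \<subseteq> plactic_alphabet n"
    using Cons.prems by (force dest: list.set_sel(2))
  have hd: "set (map hd R) \<subseteq> plactic_alphabet n"
    using Cons.prems by (force intro: hd_in_set)
  have "r @ concat R \<approx> r @ map hd R @ concat (map tl R)"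
    using Cons by (intro pres_cong_append_left) auto
  moreover have "(b # r' @ map hd R) @ concat (map tl R) \<approx>
      (b # map hd R @ r') @ concat (map tl R)"
    using Cons.prems tl hd r
    by (intro pres_cong_append_right plactic_row_column) auto
  ultimately show ?case using pres_cong_trans r by fastforce
qed

text \<open>First columns are split off along the recursion of \<open>transpose\<close>. Rows may be
  empty because tails run out; dominance keeps the empty ones at the top, where
  \<open>transpose\<close> drops them.\<close>

lemma plactic_transpose:
  assumes "successively dominates R" "\<forall>r \<in> set R. sorted r"
    and "set (concat R) \<subseteq> plactic_alphabet n"
  shows "concat R \<approx> concat (transpose R)"
  using assms
proof (induction R rule: transpose.induct)
  case 1
  then show ?case by (auto intro!: pres_cong_refl)
next
  case (2 R)
  then show ?case by (cases R) simp_all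
next
  case (3 x r R)
  let ?R = "(x # r) # R"
  have trans: "transp dominates"
  proof (rule transpI)
    fix r s t assume "dominates r s" "dominates s t"
    then show "dominates r t"
      unfolding dominates_def by (meson less_le_trans order_trans less_trans)
  qed
  have dom: "sorted_wrt dominates ?R"
    using 3(2) trans by (simp add: successively_conv_sorted_wrt del: sorted_wrt.simps)
  have ne: "s \<noteq> []" if "s \<in> set ?R" for s
    using dom that by (auto simp: dominates_def)
  have "[] \<notin> set R" using ne by auto
  \<comment> \<open>The first row is non-empty, hence so are the longer ones below it, and the
    patterns in \<open>transpose\<close> discard nothing.\<close>
  then have comprehension: "[h. (h # t) \<leftarrow> R] = map hd R" "[t. (h # t) \<leftarrow> R] = map tl R"
    by (induction R) (auto split: list.splits)
  have "hd s < hd r'" if "dominates r' s" "r' \<in> set ?R" "s \<in> set ?R" for r' s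
    using that ne by (auto simp: dominates_def hd_conv_nth)
  then have "sorted_wrt (>) (map hd ?R)"
    unfolding sorted_wrt_map by (intro sorted_wrt_mono_rel[OF _ dom])
  then have first: "concat ?R \<approx> map hd ?R @ concat (map tl ?R)"
    using 3 ne by (intro plactic_first_column) auto
  then have letters: "map hd ?R @ concat (map tl ?R) \<in> lists (plactic_alphabet n)"
    by (rule pres_cong_in_lists)
  have "dominates (tl r') (tl s)" if "dominates r' s" for r' s
    using that by (auto simp: dominates_def nth_tl)
  then have "sorted_wrt dominates (map tl ?R)"
    unfolding sorted_wrt_map by (intro sorted_wrt_mono_rel[OF _ dom])
  then have "successively dominates (map tl ?R)"
    using trans by (simp add: successively_conv_sorted_wrt del: sorted_wrt.simps)
  moreover have "\<forall>s \<in> set (map tl ?R). sorted s"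
    using 3(3) by (auto intro: sorted_tl)
  ultimately have "concat (map tl ?R) \<approx> concat (transpose (map tl ?R))"
    using 3(1) letters by (simp add: comprehension in_lists_conv_set subset_iff)
  then have "map hd ?R @ concat (map tl ?R) \<approx> map hd ?R @ concat (transpose (map tl ?R))"
    using letters by (intro pres_cong_append_left) auto
  with first have "concat ?R \<approx> map hd ?R @ concat (transpose (map tl ?R))"
    by (rule pres_cong_trans)
  then show ?case by (simp add: comprehension)
qed

lemma plactic_tableau_columns:
  assumes "tableau t" "t \<in> lists (plactic_alphabet n)"
  shows "t \<approx> concat (tableau_columns t)"
proof -
  have "concat (max_rows t) \<approx> concat (tableau_columns t)"
    unfolding tableau_columns_def using assms max_rows_decomposition(2)
    by (intro plactic_transpose) (auto simp: tableau_def max_rows_decomposition(1)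
        simp del: set_concat)
  then show ?thesis by (simp add: max_rows_decomposition(1))
qed

text \<open>This evaluates \<open>P_tableau\<close>: the tableau with columns \<open>cs\<close> lies
  in the class of \<open>w\<close>, and any other tableau there has the same columns by
  \<open>col_tableau_unique\<close>, hence is the same word.\<close>

lemma tableau_columns_P_tableau:
  assumes "col_tableau cs" "concat cs \<approx> w"
  shows "tableau_columns (P_tableau n w) = cs"
proof -
  obtain t where t: "tableau t" "tableau_columns t = cs"
    using tableau_columns_surj[OF assms(1)] .
  have "set (concat (max_rows t)) = set (concat (transpose (max_rows t)))"
    by (simp only: set_concat_transpose)
  then have "t \<in> lists (plactic_alphabet n)"
    using assms(2) t pres_cong_in_lists(1)[OF assms(2)]
    by (simp add: tableau_columns_def max_rows_decomposition(1) in_lists_conv_set del: set_concat)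
  then have tw: "t \<approx> w"
    using plactic_tableau_columns[OF t(1)] t(2) assms(2) by (auto intro: pres_cong_trans)
  have "P_tableau n w = t"
    unfolding P_tableau_def
  proof (rule the_equality)
    fix s assume s: "tableau s \<and> s \<approx> w"
    then have "s \<approx> concat (tableau_columns s)"
      by (intro plactic_tableau_columns) (auto dest: pres_cong_in_lists)
    then have "concat (tableau_columns s) \<approx> concat cs"
      using s assms(2) by (meson pres_cong_sym pres_cong_trans)
    then have "tableau_columns s = tableau_columns t"
      using s t assms(1) col_tableau_tableau_columns by (auto intro: col_tableau_unique)
    then show "s = t" using s t tableau_columns_inj by blast
  qed (use t tw in simp)
  then show ?thesis using t by simp
qed

section \<open>The rewriting system on columns\<close>

text \<open>The homomorphism of free monoids that sends each symbol to its column; it induces the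
  isomorphism with the plactic monoid.\<close>

fun eval_columns :: "col_symbol list \<Rightarrow> nat list" where
  "eval_columns [] = []"
| "eval_columns (csym \<alpha> # w) = \<alpha> @ eval_columns w"

lemma eval_columns_append [simp]: "eval_columns (u @ v) = eval_columns u @ eval_columns v"
  by (induction u rule: eval_columns.induct) auto

lemma eval_columns_map_csym [simp]: "eval_columns (map csym cs) = concat cs"
  by (induction cs) auto

lemma csym_in_col_symbols:
  "csym \<alpha> \<in> col_symbols n \<longleftrightarrow>
     \<alpha> \<noteq> [] \<and> sorted_wrt (>) \<alpha> \<and> set \<alpha> \<subseteq> plactic_alphabet n"
  by (auto simp: col_symbols_def column_def)

lemma eval_columns_lists:
  "w \<in> lists (col_symbols n) \<Longrightarrow> eval_columns w \<in> lists (plactic_alphabet n)"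
  by (induction w rule: eval_columns.induct) (auto simp: csym_in_col_symbols)

lemma eval_columns_letters:
  "\<forall>s \<in> set w. s \<in> col_symbols n \<Longrightarrow> x \<in> set (eval_columns w) \<Longrightarrow> x \<in> plactic_alphabet n"
  using eval_columns_lists[of w] by auto

text \<open>The sum of \<open>i * |\<alpha>\<^sub>i|\<close> over the positions \<open>i = 0, 1, \<dots>\<close> of a word
  \<open>c\<^bsub>\<alpha>\<^sub>0\<^esub> c\<^bsub>\<alpha>\<^sub>1\<^esub> \<dots>\<close>: a rule moves letters to the left.\<close>

fun column_weight :: "col_symbol list \<Rightarrow> nat" where
  "column_weight [] = 0"
| "column_weight (s # w) = column_weight w + length (eval_columns w)"

lemma column_weight_append:
  "column_weight (u @ v) = column_weight u + column_weight v + length u * length (eval_columns v)"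
  by (induction u) auto

section \<open>Products of two columns and the rules\<close>

lemma plactic_cong_length: "u \<approx> v \<Longrightarrow> length u = length v"
  by (induction rule: pres_cong_induct) (auto simp: plactic_relations_def)

text \<open>Inserting \<open>\<alpha>\<close> into \<open>\<beta>\<close> bumps fewer letters than
  \<open>\<beta>\<close> has. As congruent words have equal length, the new left column is longer
  than \<open>\<alpha>\<close>.\<close>

lemma column_product:
  assumes "csym \<alpha> \<in> col_symbols n" "csym \<beta> \<in> col_symbols n" "\<not> \<alpha> \<succeq>\<^sub>c \<beta>"
  obtains \<gamma> \<delta> where "csym \<gamma> \<in> col_symbols n" "\<delta> = [] \<or> csym \<delta> \<in> col_symbols n"
    "\<gamma> \<succeq>\<^sub>c \<delta>" "\<gamma> @ \<delta> \<approx> \<alpha> @ \<beta>" "length \<alpha> < length \<gamma>"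
proof -
  obtain c u where ins: "insert_word \<alpha> (rev \<beta>) = (c, u)" by fastforce
  have u: "set u \<subseteq> set \<beta>" "sorted_wrt (>) u" "fits_left c (rev u)" "length u < length \<beta>"
    using insert_column[of "rev \<alpha>" "rev \<beta>" c u] assms ins
    by (auto simp: csym_in_col_symbols sorted_wrt_rev col_succeq_iff)
  have c: "set c \<subseteq> set \<alpha> \<union> set \<beta>" "increasing c"
    using insert_word_letters(1)[of \<alpha> "rev \<beta>"] insert_word_sorted[of "rev \<beta>" \<alpha>] assms ins
    by (auto simp: csym_in_col_symbols sorted_wrt_rev)
  have "\<alpha> @ \<beta> \<approx> rev c @ u"
    using plactic_insert_word[of "rev \<beta>" \<alpha>] assms ins
    by (auto simp: csym_in_col_symbols sorted_wrt_rev)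
  then have eq: "rev c @ u \<approx> \<alpha> @ \<beta>"
    by (rule pres_cong_sym)
  show ?thesis
  proof
    show "length \<alpha> < length (rev c)"
      using plactic_cong_length[OF eq] u by simp
    then show "csym (rev c) \<in> col_symbols n"
      using c assms by (auto simp: csym_in_col_symbols sorted_wrt_rev)
    show "u = [] \<or> csym u \<in> col_symbols n"
      using u assms by (auto simp: csym_in_col_symbols)
    show "rev c \<succeq>\<^sub>c u" using u by (simp add: col_succeq_iff)
  qed (rule eq)
qed

text \<open>Covers both kinds of rules at once: an empty \<open>\<delta>\<close> stands for a
  product with a single column.\<close>

lemma tableau_columns_column_product:
  assumes "csym \<alpha> \<in> col_symbols n" "csym \<beta> \<in> col_symbols n" "\<not> \<alpha> \<succeq>\<^sub>c \<beta>"
  obtains \<gamma> \<delta> where "tableau_columns (P_tableau n (\<alpha> @ \<beta>)) = \<gamma> # (if \<delta> = [] then [] else [\<delta>])"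
    "csym \<gamma> \<in> col_symbols n" "\<delta> = [] \<or> csym \<delta> \<in> col_symbols n"
    "\<gamma> @ \<delta> \<approx> \<alpha> @ \<beta>" "length \<alpha> < length \<gamma>"
proof -
  obtain \<gamma> \<delta> where *: "csym \<gamma> \<in> col_symbols n" "\<delta> = [] \<or> csym \<delta> \<in> col_symbols n"
    "\<gamma> \<succeq>\<^sub>c \<delta>" "\<gamma> @ \<delta> \<approx> \<alpha> @ \<beta>" "length \<alpha> < length \<gamma>"
    using column_product[OF assms] .
  have "tableau_columns (P_tableau n (\<alpha> @ \<beta>)) = \<gamma> # (if \<delta> = [] then [] else [\<delta>])"
    using * by (intro tableau_columns_P_tableau) (auto simp: col_tableau_def csym_in_col_symbols)
  then show ?thesis using * that by blast
qed

lemma col_rulesE: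
  assumes "(l, r) \<in> col_rules n"
  obtains "l \<in> lists (col_symbols n)" "r \<in> lists (col_symbols n)"
    "eval_columns l \<approx> eval_columns r"
    "column_weight r < column_weight l" "length r \<le> length l" "length l = 2"
proof -
  obtain \<alpha> \<beta> where l: "l = [csym \<alpha>, csym \<beta>]" "csym \<alpha> \<in> col_symbols n" "csym \<beta> \<in> col_symbols n"
      "\<not> \<alpha> \<succeq>\<^sub>c \<beta>"
    and r: "\<exists>cs. r = map csym cs \<and> tableau_columns (P_tableau n (\<alpha> @ \<beta>)) = cs"
    using assms unfolding col_rules_def by auto
  obtain \<gamma> \<delta> where *: "tableau_columns (P_tableau n (\<alpha> @ \<beta>)) = \<gamma> # (if \<delta> = [] then [] else [\<delta>])"
    "csym \<gamma> \<in> col_symbols n" "\<delta> = [] \<or> csym \<delta> \<in> col_symbols n"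
    "\<gamma> @ \<delta> \<approx> \<alpha> @ \<beta>" "length \<alpha> < length \<gamma>"
    using tableau_columns_column_product[OF l(2-4)] .
  have r: "r = csym \<gamma> # (if \<delta> = [] then [] else [csym \<delta>])"
    using r * by auto
  \<comment> \<open>The left side has weight |\<beta>| and the right side |\<delta>|.\<close>
  have "length \<delta> < length \<beta>"
    using plactic_cong_length[OF *(4)] *(5) by simp
  then show ?thesis
    using * l r by (intro that) (auto intro: pres_cong_sym)
qed

lemma col_rules_reducible:
  assumes "csym \<alpha> \<in> col_symbols n" "csym \<beta> \<in> col_symbols n" "\<not> \<alpha> \<succeq>\<^sub>c \<beta>"
  shows "\<exists>r. ([csym \<alpha>, csym \<beta>], r) \<in> col_rules n"
proof -
  obtain \<gamma> \<delta> where "tableau_columns (P_tableau n (\<alpha> @ \<beta>)) = \<gamma> # (if \<delta> = [] then [] else [\<delta>])"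
    using tableau_columns_column_product[OF assms] by metis
  then show ?thesis using assms unfolding col_rules_def by (auto split: if_splits)
qed

lemma col_rules_step:
  assumes "(u, v) \<in> rewrite_step (col_symbols n) (col_rules n)"
  shows "u \<in> lists (col_symbols n)" "v \<in> lists (col_symbols n)"
    "eval_columns u \<approx> eval_columns v" "column_weight v < column_weight u"
proof -
  obtain p l r q where u: "u = p @ l @ q" and v: "v = p @ r @ q"
    and pq: "p \<in> lists (col_symbols n)" "q \<in> lists (col_symbols n)"
    and lr: "(l, r) \<in> col_rules n"
    using assms unfolding rewrite_step_def by blast
  from lr have lr': "l \<in> lists (col_symbols n)" "r \<in> lists (col_symbols n)"
    "eval_columns l \<approx> eval_columns r"
    "column_weight r < column_weight l" "length r \<le> length l"
    by (auto elim: col_rulesE)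
  then show "u \<in> lists (col_symbols n)" "v \<in> lists (col_symbols n)"
    using pq by (auto simp: u v)
  show "eval_columns u \<approx> eval_columns v"
    using lr'(3) pq by (auto simp: u v
        intro!: pres_cong_append_left pres_cong_append_right eval_columns_lists)
  \<comment> \<open>If the rule shortens the word, the symbols of \<open>q\<close> move to the left,
    which does not raise the weight.\<close>
  have "length r * length (eval_columns q) \<le> length l * length (eval_columns q)"
    using lr' by simp
  then show "column_weight v < column_weight u"
    using add_less_le_mono[OF lr'(4)] plactic_cong_length[OF lr'(3)]
    by (simp add: u v column_weight_append)
qed

section \<open>Normal forms and confluence\<close>

lemma irreducible_col_tableau:
  assumes "w \<in> lists (col_symbols n)"
    and "\<And>v. (w, v) \<notin> rewrite_step (col_symbols n) (col_rules n)"
  shows "\<exists>cs. w = map csym cs \<and> col_tableau cs"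
proof -
  define cs where "cs = map (\<lambda>s. case s of csym \<alpha> \<Rightarrow> \<alpha>) w"
  have w: "w = map csym cs"
    unfolding cs_def by (induction w) (auto split: col_symbol.splits)
  have "successively (\<succeq>\<^sub>c) cs"
  proof (rule ccontr)
    assume "\<not> successively (\<succeq>\<^sub>c) cs"
    then obtain i where i: "Suc i < length cs" "\<not> cs ! i \<succeq>\<^sub>c cs ! Suc i"
      by (auto simp: successively_conv_nth)
    let ?p = "map csym (take i cs)" and ?q = "map csym (drop (Suc (Suc i)) cs)"
    have "drop i cs = [cs ! i, cs ! Suc i] @ drop (Suc (Suc i)) cs"
      using i(1) by (simp add: Cons_nth_drop_Suc)
    then have "map csym (drop i cs) = [csym (cs ! i), csym (cs ! Suc i)] @ ?q"
      by simp
    then have split: "w = ?p @ [csym (cs ! i), csym (cs ! Suc i)] @ ?q"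
      using map_append[of csym "take i cs" "drop i cs"] w by simp
    have sym: "csym c \<in> col_symbols n" if "c \<in> set cs" for c
      using assms(1) that w by auto
    obtain r where r: "([csym (cs ! i), csym (cs ! Suc i)], r) \<in> col_rules n"
      using col_rules_reducible[OF sym sym i(2)] i(1) by auto
    have "?p \<in> lists (col_symbols n)" "?q \<in> lists (col_symbols n)"
      unfolding in_lists_conv_set set_map using sym
      by (blast dest: in_set_takeD in_set_dropD)+
    from rewrite_stepI[OF this r] show False using assms(2) unfolding split by blast
  qed
  moreover have "c \<noteq> [] \<and> sorted_wrt (>) c" if "c \<in> set cs" for c
  proof -
    have "csym c \<in> col_symbols n" using assms(1) that w by auto
    then show ?thesis by (simp add: csym_in_col_symbols)
  qed
  ultimately have "col_tableau cs" by (simp add: col_tableau_def)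
  then show ?thesis using w by blast
qed

lemma col_rules_steps:
  assumes "(u, v) \<in> (rewrite_step (col_symbols n) (col_rules n))\<^sup>*" "u \<in> lists (col_symbols n)"
  shows "v \<in> lists (col_symbols n) \<and> eval_columns u \<approx> eval_columns v"
  using assms
proof (induction rule: rtrancl_induct)
  case base
  then show ?case using pres_cong_refl[OF eval_columns_lists] by simp
next
  case (step v w)
  then show ?case
    using col_rules_step(2)[OF step.hyps(2)]
      pres_cong_trans[OF _ col_rules_step(3)[OF step.hyps(2)]] by simp
qed

lemma col_rules_normal_form:
  assumes "w \<in> lists (col_symbols n)"
  shows "\<exists>cs. (w, map csym cs) \<in> (rewrite_step (col_symbols n) (col_rules n))\<^sup>* \<and> col_tableau cs"
  using assms
proof (induction "column_weight w" arbitrary: w rule: less_induct)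
  case less
  show ?case
  proof (cases "\<exists>v. (w, v) \<in> rewrite_step (col_symbols n) (col_rules n)")
    case True
    then obtain v where v: "(w, v) \<in> rewrite_step (col_symbols n) (col_rules n)" by blast
    obtain cs where "(v, map csym cs) \<in> (rewrite_step (col_symbols n) (col_rules n))\<^sup>*"
        "col_tableau cs"
      using less.hyps[OF col_rules_step(4)[OF v] col_rules_step(2)[OF v]] by blast
    then show ?thesis using converse_rtrancl_into_rtrancl[OF v] by (intro exI[of _ cs]) simp
  next
    case False
    then have "\<exists>cs. w = map csym cs \<and> col_tableau cs"
      by (intro irreducible_col_tableau[OF less.prems]) simp
    then show ?thesis by auto
  qed
qed

text \<open>The normal forms of both words evaluate to congruent products of columns, so they
  coincide by \<open>col_tableau_unique\<close>. This yields confluence and also the congruence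
  generated by the rules.\<close>

lemma col_rules_common_reduct:
  assumes "u \<in> lists (col_symbols n)" "v \<in> lists (col_symbols n)"
    and "eval_columns u \<approx> eval_columns v"
  shows "\<exists>z. (u, z) \<in> (rewrite_step (col_symbols n) (col_rules n))\<^sup>* \<and>
    (v, z) \<in> (rewrite_step (col_symbols n) (col_rules n))\<^sup>*"
proof -
  let ?S = "rewrite_step (col_symbols n) (col_rules n)"
  obtain cs where cs: "(u, map csym cs) \<in> ?S\<^sup>*" "col_tableau cs"
    using col_rules_normal_form[OF assms(1)] by blast
  obtain ds where ds: "(v, map csym ds) \<in> ?S\<^sup>*" "col_tableau ds"
    using col_rules_normal_form[OF assms(2)] by blast
  have "concat cs \<approx> concat ds"
  proof (rule pres_cong_trans[OF _ pres_cong_trans[OF assms(3)]])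
    show "concat cs \<approx> eval_columns u"
      using col_rules_steps[OF cs(1) assms(1)] by (simp add: pres_cong_sym)
    show "eval_columns v \<approx> concat ds"
      using col_rules_steps[OF ds(1) assms(2)] by simp
  qed
  then have "cs = ds" by (rule col_tableau_unique[OF cs(2) ds(2)])
  then show ?thesis using cs ds by (intro exI[of _ "map csym cs"]) simp
qed

lemma pres_cong_col_rules_iff:
  "(u, v) \<in> pres_cong (col_symbols n) (col_rules n) \<longleftrightarrow>
     u \<in> lists (col_symbols n) \<and> v \<in> lists (col_symbols n) \<and>
     eval_columns u \<approx> eval_columns v"
proof
  assume *: "(u, v) \<in> pres_cong (col_symbols n) (col_rules n)"
  have "eval_columns u \<approx> eval_columns v"
    using *
  proof (induction rule: pres_cong_induct)
    case (refl w)
    then show ?case by (rule pres_cong_refl[OF eval_columns_lists])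
  next
    case (sym u v)
    then show ?case by (rule pres_cong_sym)
  next
    case (trans u v w)
    then show ?case by (rule pres_cong_trans)
  next
    case (rule p l r q)
    then show ?case by (rule col_rules_step(3)[OF rewrite_stepI])
  qed
  then show "u \<in> lists (col_symbols n) \<and> v \<in> lists (col_symbols n) \<and>
     eval_columns u \<approx> eval_columns v"
    using pres_cong_in_lists[OF *] by blast
next
  let ?S = "rewrite_step (col_symbols n) (col_rules n)"
  assume *: "u \<in> lists (col_symbols n) \<and> v \<in> lists (col_symbols n) \<and>
     eval_columns u \<approx> eval_columns v"
  then obtain z where "(u, z) \<in> ?S\<^sup>*" "(v, z) \<in> ?S\<^sup>*"
    using col_rules_common_reduct by blast
  then have "(u, z) \<in> (?S \<union> ?S\<inverse>)\<^sup>*" "(z, v) \<in> (?S \<union> ?S\<inverse>)\<^sup>*"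
    by (simp_all add: in_rtrancl_UnI rtrancl_converseI)
  then have "(u, v) \<in> (?S \<union> ?S\<inverse>)\<^sup>*"
    by (rule rtrancl_trans)
  then show "(u, v) \<in> pres_cong (col_symbols n) (col_rules n)"
    using * unfolding pres_cong_def by simp
qed

section \<open>Finiteness and completeness\<close>

lemma finite_col_symbols: "finite (col_symbols n)"
proof -
  have "col_symbols n \<subseteq> csym ` rev ` {\<alpha>. increasing \<alpha> \<and> set \<alpha> \<subseteq> {1..n}}"
    by (auto simp: col_symbols_def column_def plactic_alphabet_def image_iff sorted_wrt_rev
        intro!: exI[of _ "rev _"])
  \<comment> \<open>A column is determined by its set of letters.\<close>
  moreover have "inj_on set {\<alpha>. increasing \<alpha> \<and> set \<alpha> \<subseteq> {1..n}}"
    by (auto intro!: inj_onI strict_sorted_equal)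
  then have "finite {\<alpha>. increasing \<alpha> \<and> set \<alpha> \<subseteq> {1..n}}"
    by (rule inj_on_finite[of _ _ "Pow {1..n}"]) auto
  ultimately show ?thesis by (meson finite_imageI finite_subset)
qed

lemma finite_col_rules: "finite (col_rules n)"
proof (rule finite_subset)
  let ?L = "{w. set w \<subseteq> col_symbols n \<and> length w \<le> 2}"
  show "col_rules n \<subseteq> ?L \<times> ?L"
  proof
    fix x assume "x \<in> col_rules n"
    then show "x \<in> ?L \<times> ?L" by (cases x) (auto elim!: col_rulesE)
  qed
  show "finite (?L \<times> ?L)"
    using finite_lists_length_le[OF finite_col_symbols] by blast
qed

lemma finite_complete_col_rules: "finite_complete_rewriting_system (col_symbols n) (col_rules n)"
  unfolding finite_complete_rewriting_system_def complete_rewriting_system_def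
proof (intro conjI finite_col_symbols finite_col_rules)
  show "rewriting_system (col_symbols n) (col_rules n)"
    unfolding rewriting_system_def by (auto elim: col_rulesE)
  have "False" if "\<forall>i. (f i, f (Suc i)) \<in> rewrite_step (col_symbols n) (col_rules n)" for f
  proof -
    have "column_weight (f (Suc i)) < column_weight (f i)" for i
      using that col_rules_step(4) by blast
    then show False
      using wf_iff_no_infinite_down_chain[of less_than] wf_less_than
      by (auto dest!: spec[of _ "\<lambda>i. column_weight (f i)"])
  qed
  then show "noetherian (col_symbols n) (col_rules n)"
    unfolding noetherian_def by blast
  show "confluent (col_symbols n) (col_rules n)"
    unfolding confluent_def
  proof (intro ballI allI impI, elim conjE)
    let ?S = "rewrite_step (col_symbols n) (col_rules n)"
    fix w u v assume *: "w \<in> lists (col_symbols n)" "(w, u) \<in> ?S\<^sup>*" "(w, v) \<in> ?S\<^sup>*"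
    then show "\<exists>z. (u, z) \<in> ?S\<^sup>* \<and> (v, z) \<in> ?S\<^sup>*"
      using col_rules_steps[OF *(2,1)] col_rules_steps[OF *(3,1)]
      by (intro col_rules_common_reduct) (auto intro: pres_cong_sym pres_cong_trans)
  qed
qed

end

section \<open>The isomorphism with the plactic monoid\<close>

theorem theorem3p4:
  fixes n :: nat
  assumes "n \<ge> 1"
  shows "finite_complete_rewriting_system (col_symbols n) (col_rules n) \<and>
    (\<exists>h \<in> iso (presented_monoid (col_symbols n) (col_rules n)) (plactic_monoid n).
       \<forall>\<alpha>. csym \<alpha> \<in> col_symbols n \<longrightarrow>
         h (pres_class (col_symbols n) (col_rules n) [csym \<alpha>]) = plactic_class n \<alpha>)"
proof (intro conjI finite_complete_col_rules bexI allI impI)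
  let ?C = "col_symbols n" and ?A = "plactic_alphabet n"
  let ?cls = "pres_class ?C (col_rules n)"
  \<comment> \<open>The union avoids a choice of representatives: all the classes in it are
    equal.\<close>
  define h where "h X = (\<Union>w \<in> X. plactic_class n (eval_columns w))" for X
  have h: "h (?cls w) = plactic_class n (eval_columns w)" if "w \<in> lists ?C" for w
  proof -
    have "plactic_class n (eval_columns v) = plactic_class n (eval_columns w)" if "v \<in> ?cls w" for v
      using that by (subst pres_class_eq_iff) (auto simp: pres_class_def pres_cong_col_rules_iff
          intro: pres_cong_sym eval_columns_letters)
    moreover have "w \<in> ?cls w" using that by (simp add: pres_class_def pres_cong_refl)
    ultimately show ?thesis unfolding h_def by blast
  qed
  show "h (?cls [csym \<alpha>]) = plactic_class n \<alpha>" if "csym \<alpha> \<in> ?C" for \<alpha>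
    using that by (simp add: h)
  \<comment> \<open>Each letter is a column of length one.\<close>
  have surj: "\<exists>v \<in> lists ?C. eval_columns v = w" if "w \<in> lists ?A" for w
  proof
    show "map (\<lambda>x. csym [x]) w \<in> lists ?C"
      using that by (auto simp: csym_in_col_symbols)
    show "eval_columns (map (\<lambda>x. csym [x]) w) = w" by (induction w) auto
  qed
  show "h \<in> iso (presented_monoid ?C (col_rules n)) (plactic_monoid n)"
  proof (rule isoI)
    show "h \<in> hom (presented_monoid ?C (col_rules n)) (plactic_monoid n)"
    proof (rule homI)
      fix X assume "X \<in> carrier (presented_monoid ?C (col_rules n))"
      then obtain w where "w \<in> lists ?C" "X = ?cls w"
        unfolding carrier_presented_monoid by (rule imageE)
      then show "h X \<in> carrier (plactic_monoid n)"
        unfolding carrier_presented_monoid by (simp only: h eval_columns_lists imageI)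
    next
      fix X Y assume "X \<in> carrier (presented_monoid ?C (col_rules n))"
        "Y \<in> carrier (presented_monoid ?C (col_rules n))"
      then obtain u v where uv: "u \<in> lists ?C" "X = ?cls u" "v \<in> lists ?C" "Y = ?cls v"
        by (auto simp: carrier_presented_monoid)
      then have "u @ v \<in> lists ?C" by simp
      with uv show "h (X \<otimes>\<^bsub>presented_monoid ?C (col_rules n)\<^esub> Y) = h X \<otimes>\<^bsub>plactic_monoid n\<^esub> h Y"
        by (simp add: presented_monoid_mult h eval_columns_lists)
    qed
    show "bij_betw h (carrier (presented_monoid ?C (col_rules n))) (carrier (plactic_monoid n))"
      unfolding bij_betw_def carrier_presented_monoid
    proof
      show "inj_on h (?cls ` lists ?C)"
      proof (intro inj_onI, elim imageE)
        fix X Y u v assume "h X = h Y" and uv: "X = ?cls u" "u \<in> lists ?C" "Y = ?cls v" "v \<in> lists ?C"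
        then have "plactic_class n (eval_columns u) = plactic_class n (eval_columns v)"
          by (simp only: h)
        then show "X = Y"
          using uv by (simp only: pres_class_eq_iff eval_columns_lists pres_cong_col_rules_iff simp_thms)
      qed
      have "h ` ?cls ` lists ?C = plactic_class n ` eval_columns ` lists ?C"
        unfolding image_image by (intro image_cong refl h)
      moreover have "eval_columns ` lists ?C = lists ?A"
        using surj eval_columns_lists by blast
      ultimately show "h ` ?cls ` lists ?C = plactic_class n ` lists ?A"
        by (simp only:)
    qed
  qed
qed

end
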